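(* Let $\mathcal G$ be the group of unitaries on $n$ qubits generated by $\{P_i, Z_{\{i,j\}}, X_{[ij]}\mid 0\le i,j\le n-1,\ i\ne j\}$, let $\mathcal N$ be its subgroup generated by $\{P_i,Z_{\{i,j\}}\}$ and $\mathcal X$ its subgroup generated by $\{X_{[ij]}\}$. Then every element of $\mathcal G$ admits a unique decomposition of the form $$Z_{\mathbf v}\,P_{\mathbf b}\,Z_{\mathbf B}\,X_{\mathbf A},$$ with $\mathbf v,\mathbf b\in\mathbb F_2^n$, $\mathbf B\in\mathcal B_n$, $\mathbf A\in GL_n(\mathbb F_2)$. Moreover $\mathcal G=\mathcal N\rtimes\mathcal X$ is the semidirect product of its normal subgroup $\mathcal N$ with $\mathcal X$, and the order of $\mathcal G$ is $2^{n(n+1)}\prod_{i=1}^n(2^i-1)$.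
   Context: Qubits are labelled $0,\dots,n-1$; the computational basis of $(\mathbb C^2)^{\otimes n}$ is $\{|x\rangle : x\in\mathbb F_2^n\}$, $\mathrm{i}=\sqrt{-1}$. $P_i$ is the phase gate $\mathrm{diag}(1,\mathrm{i})$ on qubit $i$; for $\mathbf b\in\mathbb F_2^n$, $P_{\mathbf b}=\prod_iP_i^{b_i}$, so $P_{\mathbf b}|x\rangle=\mathrm{i}^{\sum_ib_ix_i}|x\rangle$ (integer sum). $Z_{\mathbf v}|x\rangle=(-1)^{\sum_iv_ix_i}|x\rangle$. For $\mathbf A\in GL_n(\mathbb F_2)$, $X_{\mathbf A}|x\rangle=|\mathbf Ax\rangle$; for $i\ne j$, $[ij]=\mathbf I+\mathbf E_{ij}$ ($\mathbf E_{ij}$ having a single 1 at entry $(i,j)$) and $X_{[ij]}$ is the CNOT gate with target $i$ and control $j$. $\mathcal B_n$ is the set of symmetric $n\times n$ matrices over $\mathbb F_2$ with zero diagonal; for $\mathbf B\in\mathcal B_n$, $Z_{\mathbf B}|x\rangle=(-1)^{\sum_{i<j}b_{ij}x_ix_j}|x\rangle$, and $Z_{\{i,j\}}$ is the CZ gate, i.e. $Z_{\mathbf B}$ for the matrix $\mathbf B$ whose only ones are at entries $(i,j)$ and $(j,i)$. *)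

theory Defs
  imports "HOL-Analysis.Analysis" "HOL-Library.Z2" "HOL-Algebra.Group" "HOL-Algebra.Generated_Groups" "HOL-Algebra.Coset"
begin

text \<open>Qubits are indexed by a finite type 'n (so n = CARD('n)); F_2 is the field bit of HOL-Library.Z2;
computational basis states are indexed by vectors x :: bit^'n. An operator on (C^2)^{tensor n}
is a complex matrix indexed by bit^'n, entry (y,x) being the amplitude of |y> in U|x>.\<close>

instance bit :: finite
proof
  have "(UNIV :: bit set) = {0, 1}" by (auto intro: bit_not_zero_iff[THEN iffD1])
  then show "finite (UNIV :: bit set)" by (metis finite.emptyI finite.insertI)
qed

definition adjoint :: "complex^'m^'m \<Rightarrow> complex^'m^'m" where
  "adjoint U = (\<chi> i j. cnj (U $ j $ i))"

definition unitary_group :: "(complex^'m^'m) monoid" where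
  "unitary_group = \<lparr>carrier = {U. U ** adjoint U = mat 1 \<and> adjoint U ** U = mat 1},
                    mult = (**), one = mat 1\<rparr>"

definition diag_op :: "('m \<Rightarrow> complex) \<Rightarrow> complex^'m^'m" where
  "diag_op f = (\<chi> y x. if y = x then f x else 0)"

text \<open>Phase gate P_i = diag(1, i) on qubit i.\<close>
definition P_gate :: "'n \<Rightarrow> complex^(bit^'n)^(bit^'n)" where
  "P_gate i = diag_op (\<lambda>x. if x $ i = 1 then \<i> else 1)"

text \<open>P_b |x> = i^(sum_i b_i x_i), integer sum.\<close>
definition P_vec :: "bit^'n \<Rightarrow> complex^(bit^'n)^(bit^'n)" where
  "P_vec b = diag_op (\<lambda>x. \<i> ^ card {i. b $ i = 1 \<and> x $ i = 1})"

text \<open>Z_v |x> = (-1)^(sum_i v_i x_i).\<close>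
definition Z_vec :: "bit^'n \<Rightarrow> complex^(bit^'n)^(bit^'n)" where
  "Z_vec v = diag_op (\<lambda>x. (-1) ^ card {i. v $ i = 1 \<and> x $ i = 1})"

text \<open>B_n: symmetric matrices over F_2 with zero diagonal.\<close>
definition Bmats :: "(bit^'n^'n) set" where
  "Bmats = {B. transpose B = B \<and> (\<forall>i. B $ i $ i = 0)}"

text \<open>Z_B |x> = (-1)^(sum_{i<j} b_ij x_i x_j); the unordered pairs {i,j} with i \<noteq> j are counted once.\<close>
definition Z_mat :: "bit^'n^'n \<Rightarrow> complex^(bit^'n)^(bit^'n)" where
  "Z_mat B = diag_op (\<lambda>x. (-1) ^ card {p. \<exists>i j. p = {i, j} \<and> i \<noteq> j \<and> B $ i $ j = 1 \<and> x $ i = 1 \<and> x $ j = 1})"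

text \<open>CZ gate Z_{i,j}.\<close>
definition CZ_gate :: "'n \<Rightarrow> 'n \<Rightarrow> complex^(bit^'n)^(bit^'n)" where
  "CZ_gate i j = Z_mat (\<chi> k l. if (k = i \<and> l = j) \<or> (k = j \<and> l = i) then 1 else 0)"

text \<open>X_A |x> = |A x>.\<close>
definition X_mat :: "bit^'n^'n \<Rightarrow> complex^(bit^'n)^(bit^'n)" where
  "X_mat A = (\<chi> y x. if y = A *v x then 1 else 0)"

text \<open>E_ij and [ij] = I + E_ij; X_[ij] is CNOT with target i, control j.\<close>
definition E_mat :: "'n \<Rightarrow> 'n \<Rightarrow> bit^'n^'n" where
  "E_mat i j = (\<chi> k l. if k = i \<and> l = j then 1 else 0)"

definition CNOT_gate :: "'n \<Rightarrow> 'n \<Rightarrow> complex^(bit^'n)^(bit^'n)" where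
  "CNOT_gate i j = X_mat (mat 1 + E_mat i j)"

definition N_gens :: "(complex^(bit^'n)^(bit^'n)) set" where
  "N_gens = range P_gate \<union> {CZ_gate i j | i j. i \<noteq> j}"

definition X_gens :: "(complex^(bit^'n)^(bit^'n)) set" where
  "X_gens = {CNOT_gate i j | i j. i \<noteq> j}"

definition G_grp :: "(complex^(bit^'n)^(bit^'n)) set" where
  "G_grp = generate unitary_group (N_gens \<union> X_gens)"

definition N_grp :: "(complex^(bit^'n)^(bit^'n)) set" where
  "N_grp = generate unitary_group N_gens"

definition X_grp :: "(complex^(bit^'n)^(bit^'n)) set" where
  "X_grp = generate unitary_group X_gens"

end

theory Submission
  imports Defs
begin

text \<open>Both generators of $\mathcal N$ are diagonal. Conjugation by a CNOT gate substitutes $x_i \oplus x_j$ for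
$x_i$ in the diagonal, and this keeps the group of diagonals generated by $\mathrm{i}^{x_i}$ and
$(-1)^{x_i x_j}$ invariant. As transvections generate $GL_n(\mathbb F_2)$ (Gaussian elimination), the products
of such a diagonal with a permutation matrix $X_{\mathbf A}$ form a group, which is $\mathcal G$. The parameters
$\mathbf v, \mathbf b$ are read off a diagonal at the weight one vectors, $\mathbf B$ at the weight two vectors,
and $\mathbf A$ off the support of the matrix; this gives uniqueness, and the order by counting
parameters.\<close>

section \<open>The general linear group over the field with two elements\<close>

text \<open>\<open>P_gate i\<close> has order four while all parameters are bits. The pair
  \<open>v $ i\<close>, \<open>b $ i\<close> consists of the high and the low binary digit of an
  exponent of \<open>\<i>\<close> modulo 4, which is why there are two linear parameters although Z
  is not among the generators. A quadratic monomial enters the exponent of \<open>\<i>\<close> with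
  coefficient 2, so it matters only modulo 2. This is why the diagonals survive a linear
  substitution without growing in degree: a linear term modulo 4 produces at most quadratic terms
  times 2, and quadratic terms modulo 2 expand bilinearly into quadratic and linear ones. The
  factorisation into transvections serves twice: it places every \<open>X_mat A\<close> with
  \<open>A\<close> invertible in the CNOT group, and it extends the invariance of the diagonals from
  one CNOT to all invertible substitutions.\<close>

lemma bit_add_self [simp]: "(a::bit) + a = 0"
  by (cases a) simp_all

lemma bit_vec_add_self [simp]: "(x :: bit^'n) + x = 0"
  by (simp add: vec_eq_iff)

lemma bit_vec_add_eq_0_iff: "x + y = 0 \<longleftrightarrow> x = (y :: bit^'n)"
  by (metis add.assoc add.right_neutral add.left_neutral bit_vec_add_self)

lemma card_UNIV_bit [simp]: "CARD(bit) = 2"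
proof -
  have "(UNIV :: bit set) = {0, 1}"
    by (auto intro: bit.exhaust)
  moreover have "card {0, 1 :: bit} = 2"
    by (simp only: card_2_iff) auto
  ultimately show ?thesis by metis
qed

section \<open>Gaussian elimination by transvections\<close>

inductive_set transvections :: "(bit^'n^'n) set" where
  one: "mat 1 \<in> transvections"
| elementary: "i \<noteq> j \<Longrightarrow> mat 1 + E_mat i j \<in> transvections"
| mult: "A \<in> transvections \<Longrightarrow> B \<in> transvections \<Longrightarrow> A ** B \<in> transvections"

lemma transvection_apply: "(mat 1 + E_mat i j) *v x = x + axis i (x $ j)"
proof -
  have "(E_mat i j *v x) $ k = axis i (x $ j) $ k" for k
  proof -
    have "(E_mat i j *v x) $ k = (\<Sum>l\<in>UNIV. if l = j then axis i (x $ j) $ k else 0)"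
      unfolding matrix_vector_mult_def E_mat_def axis_def vec_lambda_beta
      by (rule sum.cong) auto
    then show ?thesis by simp
  qed
  then have "E_mat i j *v x = axis i (x $ j)"
    by (simp add: vec_eq_iff)
  then show ?thesis by (simp add: matrix_vector_mult_add_rdistrib)
qed

lemma transvection_involution:
  assumes "i \<noteq> j"
  shows "(mat 1 + E_mat i j) ** (mat 1 + E_mat i j) = (mat 1 :: bit^'n^'n)"
proof -
  have "((mat 1 + E_mat i j) ** (mat 1 + E_mat i j)) *v x = mat 1 *v x" for x :: "bit^'n"
    using assms by (simp flip: matrix_vector_mul_assoc add: transvection_apply)
      (simp add: vec_eq_iff axis_def add.assoc)
  then show ?thesis by (simp add: matrix_eq)
qed

text \<open>Inverses are not built into the inductive set. They exist because each elementary
  transvection is an involution, so that a product is inverted by reversing its factors.\<close>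

lemma transvections_inverse:
  "A \<in> transvections \<Longrightarrow> \<exists>B \<in> transvections. A ** B = mat 1 \<and> B ** A = mat 1"
proof (induction rule: transvections.induct)
  case one
  then show ?case using transvections.one by auto
next
  case (elementary i j)
  then show ?case using transvections.elementary transvection_involution by blast
next
  case (mult A B)
  then obtain A' B' where "A' \<in> transvections" "A ** A' = mat 1" "A' ** A = mat 1"
      "B' \<in> transvections" "B ** B' = mat 1" "B' ** B = mat 1"
    by blast
  then have "B' ** A' \<in> transvections" "(A ** B) ** (B' ** A') = mat 1"
      "(B' ** A') ** (A ** B) = mat 1"
    by (auto intro: transvections.mult simp: matrix_mul_assoc)
       (metis matrix_mul_assoc matrix_mul_rid)+
  then show ?case by blast
qed

lemma transvections_invertible: "A \<in> transvections \<Longrightarrow> invertible A"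
  using transvections_inverse unfolding invertible_def by blast

text \<open>One elementary transvection is applied for each \<open>m\<close> with
  \<open>c $ m = 1\<close>. As \<open>c $ k = 0\<close>, none of them changes coordinate
  \<open>k\<close>, so every factor adds the same original value \<open>x $ k\<close>. The induction
  over \<open>S\<close> truncates \<open>c\<close> to the coordinates treated so far.\<close>

lemma column_clearing_transvection:
  fixes c :: "bit^'n"
  assumes "c $ k = 0"
  shows "\<exists>T \<in> transvections. \<forall>x. T *v x = x + x $ k *s c"
proof -
  have "\<exists>T \<in> transvections. \<forall>x. T *v x = x + (\<chi> i. if i \<in> S then x $ k * c $ i else 0)"
    if "finite S" for S
    using that
  proof induction
    case empty
    have "\<forall>x. mat 1 *v x = x + (\<chi> i. if i \<in> {} then x $ k * c $ i else 0)"
      by (simp add: vec_eq_iff)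
    then show ?case using transvections.one by blast
  next
    case (insert m S)
    then obtain T where T: "T \<in> transvections"
      "\<And>x. T *v x = x + (\<chi> i. if i \<in> S then x $ k * c $ i else 0)" by blast
    show ?case
    proof (cases "c $ m = 0")
      case True
      then show ?thesis using T by (intro bexI[of _ T]) (auto simp: vec_eq_iff)
    next
      case False
      then have "m \<noteq> k" using assms by auto
      then have "(mat 1 + E_mat m k) ** T \<in> transvections"
        using T by (intro transvections.intros)
      moreover have "\<forall>x. ((mat 1 + E_mat m k) ** T) *v x =
          x + (\<chi> i. if i \<in> insert m S then x $ k * c $ i else 0)"
        using False insert.hyps assms
        by (auto simp flip: matrix_vector_mul_assoc simp add: transvection_apply T vec_eq_iff axis_def)
      ultimately show ?thesis by blast
    qed
  qed
  from this[of UNIV] show ?thesis by (simp add: vector_scalar_mult_def)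
qed

text \<open>Row reduction, with \<open>S\<close> the set of columns already turned into unit
  vectors. Rows are never swapped: a missing pivot is created by adding another row. At the end
  \<open>T ** A\<close> is the identity and \<open>A\<close> is the inverse of
  \<open>T\<close>.\<close>

lemma invertible_imp_transvections:
  fixes A :: "bit^'n^'n"
  assumes "invertible A"
  shows "A \<in> transvections"
proof -
  have "\<exists>T \<in> transvections. \<forall>j\<in>S. T *v (A *v axis j 1) = axis j 1" if "finite S" for S :: "'n set"
    using that
  proof induction
    case empty
    show ?case using transvections.one by auto
  next
    case (insert k S)
    then obtain T where T: "T \<in> transvections" "\<And>j. j \<in> S \<Longrightarrow> T *v (A *v axis j 1) = axis j 1"
      by blast
    define a where "a = T *v (A *v axis k 1)"
    have inj: "inj ((*v) (T ** A))"
      by (intro inj_matrix_vector_mult invertible_mult assms transvections_invertible T)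
    \<comment> \<open>A pivot exists outside \<open>S\<close>: otherwise \<open>a\<close> is a
      combination of unit vectors indexed by \<open>S\<close>, all fixed by \<open>T ** A\<close>.
      Then \<open>T ** A\<close> maps both this combination and \<open>axis k 1\<close> to
      \<open>a\<close>, against injectivity because \<open>k\<close> is not in
      \<open>S\<close>.\<close>
    have "\<exists>i. i \<notin> S \<and> a $ i = 1"
    proof (rule ccontr)
      assume "\<nexists>i. i \<notin> S \<and> a $ i = 1"
      then have 0: "a $ i = 0" if "i \<notin> S" for i
        using that bit_not_one_iff by blast
      have "(T ** A) *v (\<Sum>j\<in>S. a $ j *s axis j 1) = (\<Sum>j\<in>S. a $ j *s axis j 1)"
        by (simp add: vec.sum vec.scale matrix_vector_mul_assoc[symmetric] T
            matrix_vector_mult_scaleR)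
      also have "\<dots> = a"
      proof -
        have "(\<Sum>j\<in>S. a $ j * (axis j 1 :: bit^'n) $ i) = a $ i" for i
        proof -
          have "(\<Sum>j\<in>S. a $ j * (axis j 1 :: bit^'n) $ i) = (\<Sum>j\<in>S. if j = i then a $ i else 0)"
            by (rule sum.cong) (auto simp: axis_def)
          then show ?thesis using 0 \<open>finite S\<close> by simp
        qed
        then show ?thesis by (simp add: vec_eq_iff)
      qed
      also have "\<dots> = (T ** A) *v axis k 1"
        by (simp add: a_def matrix_vector_mul_assoc)
      finally have "(\<Sum>j\<in>S. a $ j *s axis j 1) = axis k 1"
        using inj by (simp add: inj_def)
      then have "(\<Sum>j\<in>S. a $ j *s axis j 1) $ k = (axis k 1 :: bit^'n) $ k" by simp
      moreover have "(\<Sum>j\<in>S. a $ j *s axis j 1) $ k = 0"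
        unfolding sum_component
        by (rule sum.neutral) (use \<open>k \<notin> S\<close> in \<open>auto simp: axis_def\<close>)
      ultimately show False by simp
    qed
    then obtain i where i: "i \<notin> S" "a $ i = 1" by blast
    \<comment> \<open>If entry \<open>k\<close> is zero, row \<open>i\<close> is added to row
      \<open>k\<close>. The finished columns have a zero in row \<open>i\<close>, as
      \<open>i\<close> is not in \<open>S\<close>, and stay intact.\<close>
    have "\<exists>T' \<in> transvections. (T' *v a) $ k = 1 \<and> (\<forall>j\<in>S. T' *v axis j 1 = axis j 1)"
    proof (cases "a $ k = 1")
      case True
      then show ?thesis using transvections.one by (intro bexI[of _ "mat 1"]) auto
    next
      case False
      then have "k \<noteq> i" using i by auto
      then have "mat 1 + E_mat k i \<in> transvections" by (rule transvections.elementary)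
      moreover have "((mat 1 + E_mat k i) *v a) $ k = 1"
        using False i by (simp add: transvection_apply axis_def)
      moreover have "\<forall>j\<in>S. (mat 1 + E_mat k i) *v axis j 1 = axis j 1"
        using i by (auto simp: transvection_apply axis_def vec_eq_iff)
      ultimately show ?thesis by blast
    qed
    then obtain T' where T': "T' \<in> transvections" "(T' *v a) $ k = 1"
      "\<And>j. j\<in>S \<Longrightarrow> T' *v axis j 1 = axis j 1" by blast
    \<comment> \<open>\<open>T' *v a + axis k 1\<close> is the current column with its pivot erased.
      Adding it to the column leaves \<open>axis k 1\<close>, while unit vectors with a zero at
      \<open>k\<close> are fixed.\<close>
    obtain T'' where T'': "T'' \<in> transvections"
      "\<And>x. T'' *v x = x + x $ k *s (T' *v a + axis k 1)"
      using column_clearing_transvection[of "T' *v a + axis k 1" k] T'(2) by (auto simp: axis_def)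
    have "T'' ** T' ** T \<in> transvections"
      using T T' T'' by (intro transvections.mult)
    moreover have "(T'' ** T' ** T) *v (A *v axis j 1) = axis j 1" if "j \<in> insert k S" for j
    proof (cases "j = k")
      case True
      have "(T'' ** T' ** T) *v (A *v axis j 1) = T'' *v (T' *v a)"
        by (simp only: True a_def matrix_vector_mul_assoc matrix_mul_assoc)
      also have "\<dots> = axis k 1"
        using T' by (simp add: T'' add.assoc[symmetric])
      finally show ?thesis using True by simp
    next
      case False
      then have "(T'' ** T' ** T) *v (A *v axis j 1) = T'' *v (T' *v (T *v (A *v axis j 1)))"
        by (simp only: a_def matrix_vector_mul_assoc matrix_mul_assoc)
      also have "\<dots> = axis j 1"
        using False that by (simp add: T T' T'') (simp add: axis_def)
      finally show ?thesis .
    qed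
    ultimately show ?case by blast
  qed
  from this[of UNIV] obtain T where T: "T \<in> transvections" "\<And>j. T *v (A *v axis j 1) = axis j 1"
    by auto
  have "column j (T ** A) = column j (mat 1)" for j
  proof -
    have "column j M = M *v axis j 1" for M :: "bit^'n^'n"
      by (simp add: matrix_vector_mult_def column_def axis_def vec_eq_iff if_distrib cong: if_cong)
    then show ?thesis using T(2)[of j] by (simp add: matrix_vector_mul_assoc)
  qed
  then have "T ** A = mat 1"
    by (simp add: column_def vec_eq_iff)
  moreover obtain B where "B \<in> transvections" "B ** T = mat 1"
    using transvections_inverse[OF T(1)] by blast
  ultimately show ?thesis
    by (metis matrix_mul_assoc matrix_mul_lid matrix_mul_rid)
qed

text \<open>Over $\mathbb F_2$, linear combinations are sums over subsets.\<close>

definition subset_independent :: "'i set \<Rightarrow> ('i \<Rightarrow> bit^'n) \<Rightarrow> bool" where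
  "subset_independent S f \<longleftrightarrow> (\<forall>U \<subseteq> S. sum f U = 0 \<longrightarrow> U = {})"

text \<open>If two subsets have equal sums, the terms over their intersection cancel in
  characteristic two; hence their symmetric difference sums to zero and is empty.\<close>

lemma subset_independent_card_sums:
  assumes "finite S" "subset_independent S f"
  shows "card (sum f ` Pow S) = 2 ^ card S"
proof -
  have "inj_on (sum f) (Pow S)"
  proof (rule inj_onI)
    fix U V assume UV: "U \<in> Pow S" "V \<in> Pow S" "sum f U = sum f V"
    then have fin: "finite U" "finite V" using assms(1) finite_subset by auto
    have "sum f ((U - V) \<union> (V - U)) = sum f (U - V) + sum f (V - U)"
      using fin by (intro sum.union_disjoint) auto
    also have "\<dots> = (sum f (U - V) + sum f (U \<inter> V)) + (sum f (V - U) + sum f (V \<inter> U))"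
      by (simp add: Int_commute add.left_commute add.assoc)
    also have "\<dots> = sum f U + sum f V"
      using fin by (simp add: sum.Int_Diff[of U f V] sum.Int_Diff[of V f U] add.commute)
    also have "\<dots> = 0" using UV by simp
    finally have "sum f ((U - V) \<union> (V - U)) = 0" .
    moreover have "(U - V) \<union> (V - U) \<subseteq> S" using UV by blast
    ultimately have "(U - V) \<union> (V - U) = {}"
      using assms(2) by (simp only: subset_independent_def)
    then show "U = V" by blast
  qed
  then show ?thesis using assms(1) by (simp add: card_image card_Pow)
qed

lemma subset_independent_insert:
  assumes "finite S" "k \<notin> S"
  shows "subset_independent (insert k S) f \<longleftrightarrow> subset_independent S f \<and> f k \<notin> sum f ` Pow S"
proof -
  have *: "sum f (insert k U) = 0 \<longleftrightarrow> f k = sum f U" if "U \<subseteq> S" for U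
    using that assms finite_subset by (subst sum.insert) (auto simp: bit_vec_add_eq_0_iff)
  have "(\<forall>U \<subseteq> insert k S. P U) \<longleftrightarrow> (\<forall>U \<subseteq> S. P U) \<and> (\<forall>U \<subseteq> S. P (insert k U))" for P
  proof -
    have "(\<forall>U \<in> Pow (insert k S). P U) \<longleftrightarrow> (\<forall>U \<in> Pow S. P U) \<and> (\<forall>U \<in> Pow S. P (insert k U))"
      unfolding Pow_insert by blast
    then show ?thesis by auto
  qed
  then have "subset_independent (insert k S) f \<longleftrightarrow>
      subset_independent S f \<and> (\<forall>U \<subseteq> S. sum f (insert k U) \<noteq> 0)"
    by (simp add: subset_independent_def)
  also have "(\<forall>U \<subseteq> S. sum f (insert k U) \<noteq> 0) \<longleftrightarrow> f k \<notin> sum f ` Pow S"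
    by (auto simp only: * image_iff Pow_iff)
  finally show ?thesis .
qed

text \<open>The vectors are chosen one after another: after \<open>i\<close> choices the next must
  avoid the \<open>2 ^ i\<close> distinct subset sums of the earlier ones. Extensional functions
  ensure that each family over \<open>S\<close> is counted once.\<close>

lemma card_subset_independent:
  assumes "finite (S :: 'i set)"
  shows "card {f \<in> S \<rightarrow>\<^sub>E (UNIV :: (bit^'n) set). subset_independent S f} =
    (\<Prod>i<card S. 2 ^ CARD('n) - 2 ^ i)"
  using assms
proof induction
  case empty
  then show ?case by (simp add: subset_independent_def)
next
  case (insert k S)
  let ?I = "\<lambda>S. {f \<in> S \<rightarrow>\<^sub>E (UNIV :: (bit^'n) set). subset_independent S f}"
  have upd: "subset_independent S (g(k := y)) = subset_independent S g"
    "sum (g(k := y)) ` Pow S = sum g ` Pow S" for g and y :: "bit^'n"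
  proof -
    have "sum (g(k := y)) U = sum g U" if "U \<subseteq> S" for U
      using that insert.hyps by (intro sum.cong) auto
    then show "subset_independent S (g(k := y)) = subset_independent S g"
      "sum (g(k := y)) ` Pow S = sum g ` Pow S"
      by (auto simp: subset_independent_def image_iff)
  qed
  have "bij_betw (\<lambda>(f, y). f(k := y)) (SIGMA f : ?I S. UNIV - sum f ` Pow S) (?I (insert k S))"
  \<comment> \<open>The inverse splits off the vector at \<open>k\<close>. The rest is reset to
    \<open>undefined\<close> there so that it is extensional on \<open>S\<close> again.\<close>
  proof (rule bij_betw_byWitness[where f' = "\<lambda>g. (g(k := undefined), g k)"])
    show "\<forall>a\<in>(SIGMA f : ?I S. UNIV - sum f ` Pow S).
        (\<lambda>g. (g(k := undefined), g k)) ((\<lambda>(f, y). f(k := y)) a) = a"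
      using insert.hyps by (auto simp: PiE_def extensional_def fun_eq_iff)
    show "\<forall>g\<in>?I (insert k S). (\<lambda>(f, y). f(k := y)) (g(k := undefined), g k) = g"
      by auto
    have upd_in: "f(k := y) \<in> ?I (insert k S)" if "f \<in> ?I S" "y \<notin> sum f ` Pow S" for f y
    proof -
      have "(f(k := y)) k \<notin> sum (f(k := y)) ` Pow S"
        using that unfolding upd by simp
      then have "subset_independent (insert k S) (f(k := y))"
        using that by (simp only: subset_independent_insert[OF insert.hyps] upd(1)) simp
      moreover have "f(k := y) \<in> insert k S \<rightarrow>\<^sub>E UNIV"
        using that(1) by (auto simp: PiE_def extensional_def)
      ultimately show ?thesis by simp
    qed
    show "(\<lambda>(f, y). f(k := y)) ` (SIGMA f : ?I S. UNIV - sum f ` Pow S) \<subseteq> ?I (insert k S)"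
      by (intro image_subsetI, elim SigmaE, simp only: prod.case, rule upd_in)
        (assumption, erule DiffE, assumption)
    have "g(k := undefined) \<in> ?I S" "g k \<notin> sum (g(k := undefined)) ` Pow S"
      if "g \<in> ?I (insert k S)" for g
    proof -
      have ind: "subset_independent S g" "g k \<notin> sum g ` Pow S"
        using that subset_independent_insert[OF insert.hyps] by auto
      show "g k \<notin> sum (g(k := undefined)) ` Pow S"
        using ind unfolding upd by simp
      show "g(k := undefined) \<in> ?I S"
        using ind(1) that insert.hyps(2) unfolding mem_Collect_eq upd(1)
        by (auto simp: PiE_def extensional_def)
    qed
    then show "(\<lambda>g. (g(k := undefined), g k)) ` ?I (insert k S) \<subseteq> (SIGMA f : ?I S. UNIV - sum f ` Pow S)"
      by (intro image_subsetI SigmaI DiffI UNIV_I)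
  qed
  then have "card (?I (insert k S)) = card (SIGMA f : ?I S. UNIV - sum f ` Pow S)"
    by (simp add: bij_betw_same_card)
  also have "\<dots> = (\<Sum>f\<in>?I S. card (UNIV - sum f ` Pow S))"
    using insert.hyps by (intro card_SigmaI) (auto intro: finite_subset[OF _ finite_PiE])
  also have "\<dots> = (\<Sum>f\<in>?I S. 2 ^ CARD('n) - 2 ^ card S)"
    using insert.hyps
    by (intro sum.cong) (simp_all add: card_Diff_subset subset_independent_card_sums)
  finally show ?case using insert by simp
qed

lemma card_invertible_bit:
  "card {A :: bit^'n^'n. invertible A} = (\<Prod>i<CARD('n). 2 ^ CARD('n) - 2 ^ i)"
proof -
  have indep: "invertible A \<longleftrightarrow> subset_independent UNIV (\<lambda>i. column i A)" for A :: "bit^'n^'n"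
  proof -
    \<comment> \<open>The product adds up the columns on the support of \<open>x\<close>. Kernel
      vectors thus correspond to subsets of columns with sum zero, and invertibility becomes
      independence of the columns.\<close>
    have A: "A *v x = (\<Sum>i \<in> {i. x $ i = 1}. column i A)" for x
    proof -
      have "A *v x = (\<Sum>i\<in>UNIV. if x $ i = 1 then column i A else 0)"
        by (auto simp: matrix_mult_sum intro!: sum.cong)
      then show ?thesis by (simp add: sum.If_cases)
    qed
    have "invertible A \<longleftrightarrow> (\<forall>x. A *v x = 0 \<longrightarrow> x = 0)"
      by (simp add: invertible_left_inverse matrix_left_invertible_ker)
    also have "\<dots> \<longleftrightarrow> subset_independent UNIV (\<lambda>i. column i A)"
      unfolding subset_independent_def A
    proof safe
      fix U i assume *: "\<forall>x :: bit^'n. (\<Sum>i | x $ i = 1. column i A) = 0 \<longrightarrow> x = 0"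
        "(\<Sum>i\<in>U. column i A) = 0" "i \<in> U"
      define x :: "bit^'n" where "x = (\<chi> i. if i \<in> U then 1 else 0)"
      have U: "{i. x $ i = 1} = U" by (auto simp: x_def)
      have "x = 0" by (rule *(1)[rule_format]) (simp only: U *(2))
      then have "x $ i = 0" by simp
      then show "i \<in> {}" using \<open>i \<in> U\<close> by (simp add: x_def)
    next
      fix x :: "bit^'n" assume "\<forall>U\<subseteq>UNIV. (\<Sum>i\<in>U. column i A) = 0 \<longrightarrow> U = {}"
        "(\<Sum>i | x $ i = 1. column i A) = 0"
      then have "{i. x $ i = 1} = {}" by blast
      then have "x $ i = 0" for i using bit_not_one_iff by blast
      then show "x = 0" by (simp add: vec_eq_iff)
    qed
    finally show ?thesis .
  qed
  have "bij_betw (\<lambda>A i. column i A) {A :: bit^'n^'n. invertible A}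
      {f \<in> UNIV \<rightarrow>\<^sub>E UNIV. subset_independent UNIV f}"
  proof (rule bij_betw_byWitness[where f' = "\<lambda>f. \<chi> i j. f j $ i"])
    have "(\<lambda>i. column i (\<chi> i j. f j $ i)) = f" for f :: "'n \<Rightarrow> bit^'n"
      by (simp add: column_def fun_eq_iff)
    then show "\<forall>f\<in>{f \<in> UNIV \<rightarrow>\<^sub>E (UNIV :: (bit^'n) set). subset_independent UNIV f}.
        (\<lambda>i :: 'n. column i (\<chi> i j. f j $ i)) = f"
      "(\<lambda>f. \<chi> i j. f j $ i) ` {f \<in> UNIV \<rightarrow>\<^sub>E UNIV. subset_independent UNIV f} \<subseteq>
        {A :: bit^'n^'n. invertible A}"
      by (auto simp only: indep)
  qed (auto simp: indep column_def)
  then show ?thesis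
    using card_subset_independent[of "UNIV :: 'n set", where 'n = 'n] by (simp add: bij_betw_same_card)
qed

text \<open>Each factor releases \<open>2 ^ i\<close> and leaves \<open>2 ^ (n - i) - 1\<close>; the
  exponents released sum to \<open>n choose 2\<close>, and the remaining factors are listed in
  reverse order.\<close>

lemma prod_power_diff:
  "(\<Prod>i<n. 2 ^ n - 2 ^ i :: nat) = 2 ^ (n choose 2) * (\<Prod>i = 1..n. 2 ^ i - 1)"
proof -
  have "(\<Prod>i<n. 2 ^ n - 2 ^ i :: nat) = (\<Prod>i<n. 2 ^ i * (2 ^ (n - i) - 1))"
    by (intro prod.cong) (auto simp: diff_mult_distrib2 simp flip: power_add)
  also have "\<dots> = 2 ^ (\<Sum>i<n. i) * (\<Prod>i<n. 2 ^ (n - i) - 1)"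
    by (simp add: prod.distrib power_sum)
  also have "(\<Prod>i<n. 2 ^ (n - i) - 1 :: nat) = (\<Prod>i = 1..n. 2 ^ i - 1)"
    by (rule prod.reindex_bij_witness[of _ "\<lambda>i. n - i" "\<lambda>i. n - i"]) auto
  also have "(\<Sum>i<n. i) = n choose 2"
    by (induction n) (simp_all add: numeral_2_eq_2)
  finally show ?thesis .
qed

section \<open>Quadratic phases\<close>

text \<open>Diagonals are treated as functions, so that operator products become pointwise products.
  Inverses are not imposed; they are supplied by \<open>phase_cnj\<close>, because all values have
  norm one.\<close>

inductive_set phase :: "(bit^'n \<Rightarrow> complex) set" where
  one: "(\<lambda>_. 1) \<in> phase"
| P: "(\<lambda>x. if x $ i = 1 then \<i> else 1) \<in> phase"
| CZ: "i \<noteq> j \<Longrightarrow> (\<lambda>x. if x $ i = 1 \<and> x $ j = 1 then -1 else 1) \<in> phase"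
| mult: "f \<in> phase \<Longrightarrow> g \<in> phase \<Longrightarrow> (\<lambda>x. f x * g x) \<in> phase"

text \<open>Z is the square of the phase gate.\<close>

lemma phase_Z: "(\<lambda>x :: bit^'n. if x $ i = 1 then -1 else 1) \<in> phase"
proof -
  have *: "(if x $ i = 1 then -1 else 1 :: complex) =
      (if x $ i = 1 then \<i> else 1) * (if x $ i = 1 then \<i> else 1)" for x :: "bit^'n"
    by simp
  show ?thesis unfolding * by (rule phase.mult[OF phase.P phase.P])
qed

lemma phase_prod:
  assumes "finite S" "\<And>s. s \<in> S \<Longrightarrow> F s \<in> phase"
  shows "(\<lambda>x. \<Prod>s\<in>S. F s x) \<in> phase"
  using assms by (induction) (auto intro: phase.intros)

text \<open>The conjugate of a P factor is that factor times a Z factor, since \<open>-\<i>\<close>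
  is \<open>\<i>\<close> times \<open>-1\<close>; CZ factors are real.\<close>

lemma phase_cnj: "(f :: bit^'n \<Rightarrow> complex) \<in> phase \<Longrightarrow> (\<lambda>x. cnj (f x)) \<in> phase"
proof (induction rule: phase.induct)
  case (P i)
  have *: "cnj (if x $ i = 1 then \<i> else 1) =
      (if x $ i = 1 then \<i> else 1) * (if x $ i = 1 then -1 else 1)" for x :: "bit^'n"
    by simp
  show ?case unfolding * by (rule phase.mult[OF phase.P phase_Z])
next
  case (CZ i j)
  have *: "cnj (if x $ i = 1 \<and> x $ j = 1 then -1 else 1) =
      (if x $ i = 1 \<and> x $ j = 1 then -1 else 1)" for x :: "bit^'n"
    by simp
  show ?case unfolding * by (rule phase.CZ[OF CZ])
qed (auto intro: phase.intros)

lemma phase_norm: "f \<in> phase \<Longrightarrow> norm (f x) = 1"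
  by (induction rule: phase.induct) (auto simp: norm_mult)

text \<open>The quadratic terms appear here: $x_i \oplus x_j = x_i + x_j - 2 x_i x_j$ in the exponent of $\mathrm{i}$.\<close>

lemma phase_transvection:
  fixes f :: "bit^'n \<Rightarrow> complex"
  assumes "f \<in> phase" "i \<noteq> j"
  shows "(\<lambda>x. f (x + axis i (x $ j))) \<in> phase"
  using assms(1)
proof (induction rule: phase.induct)
  case (P k)
  show ?case
  proof (cases "k = i")
    case True
    have *: "(if (x + axis i (x $ j)) $ k = 1 then \<i> else 1) =
      (if x $ i = 1 then \<i> else 1) * (if x $ j = 1 then \<i> else 1) *
      (if x $ i = 1 \<and> x $ j = 1 then -1 else 1)" for x :: "bit^'n"
      using True by (cases "x $ i"; cases "x $ j") (simp_all add: axis_def)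
    show ?thesis
      unfolding * using \<open>i \<noteq> j\<close> by (intro phase.mult phase.P phase.CZ)
  next
    case False
    then show ?thesis by (simp add: axis_def phase.P)
  qed
next
  case (CZ k l)
  have *: "(\<lambda>x. if (x + axis i (x $ j)) $ i = 1 \<and> (x + axis i (x $ j)) $ l = 1 then -1 else 1) \<in> phase"
    if "i \<noteq> l" for l
  proof -
    have **: "(if (x + axis i (x $ j)) $ i = 1 \<and> (x + axis i (x $ j)) $ l = 1 then -1 else 1 :: complex) =
      (if x $ i = 1 \<and> x $ l = 1 then -1 else 1) * (if x $ j = 1 \<and> x $ l = 1 then -1 else 1)" for x :: "bit^'n"
      using that by (cases "x $ i"; cases "x $ j"; cases "x $ l") (simp_all add: axis_def)
    show ?thesis
    \<comment> \<open>The monomial \<open>x $ i * x $ l\<close> becomes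
      \<open>x $ i * x $ l + x $ j * x $ l\<close>. When \<open>j = l\<close> the second term is a
      square, hence linear, and gives a Z factor instead of a CZ factor.\<close>
    proof (cases "j = l")
      case True
      then show ?thesis unfolding ** using that by (auto intro!: phase.mult phase.CZ phase_Z)
    next
      case False
      then show ?thesis unfolding ** using that by (auto intro!: phase.mult phase.CZ)
    qed
  qed
  consider "k = i" | "l = i" | "k \<noteq> i" "l \<noteq> i" by blast
  then show ?case
  proof cases
    case 1
    then show ?thesis using *[of l] CZ by simp
  next
    case 2
    then show ?thesis using *[of k] CZ by (simp add: conj_commute)
  next
    case 3
    then show ?thesis using phase.CZ[OF CZ] by (simp add: axis_def)
  qed
qed (auto intro: phase.intros)

text \<open>Induction on the factorisation into transvections. For a product the hypothesis for
  \<open>B\<close> is applied to \<open>f\<close> already composed with \<open>A\<close>, so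
  \<open>f\<close> has to stay arbitrary.\<close>

lemma phase_linear_subst:
  fixes A :: "bit^'n^'n"
  assumes "invertible A" "f \<in> phase"
  shows "(\<lambda>x. f (A *v x)) \<in> phase"
proof -
  have "A \<in> transvections" using assms(1) by (rule invertible_imp_transvections)
  then show ?thesis using assms(2)
  proof (induction arbitrary: f rule: transvections.induct)
    case (mult A B)
    show ?case
      using mult.IH(2)[OF mult.IH(1)[OF mult.prems]] by (simp add: matrix_vector_mul_assoc)
  qed (auto simp: transvection_apply phase_transvection)
qed

section \<open>Normal forms of quadratic phases\<close>

definition normal_phase :: "bit^'n \<Rightarrow> bit^'n \<Rightarrow> bit^'n^'n \<Rightarrow> bit^'n \<Rightarrow> complex" where
  "normal_phase v b B x = (-1) ^ card {i. v $ i = 1 \<and> x $ i = 1} *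
     \<i> ^ card {i. b $ i = 1 \<and> x $ i = 1} *
     (-1) ^ card {p. \<exists>i j. p = {i, j} \<and> i \<noteq> j \<and> B $ i $ j = 1 \<and> x $ i = 1 \<and> x $ j = 1}"

text \<open>Turns an exponent that counts into a product of local factors, so that identities can be
  checked one index or one pair at a time.\<close>

lemma power_card_Collect:
  "(a :: 'b :: comm_monoid_mult) ^ card {i :: 'a :: finite. Q i} = (\<Prod>i\<in>UNIV. if Q i then a else 1)"
  by (simp add: prod.If_cases)

lemma Bmats_sym: "B \<in> Bmats \<Longrightarrow> B $ i $ j = B $ j $ i"
  by (auto simp: Bmats_def transpose_def vec_eq_iff)

lemma Bmats_pair:
  assumes "B \<in> Bmats" "k \<noteq> l"
  shows "(\<exists>i j. {k, l} = {i, j} \<and> i \<noteq> j \<and> B $ i $ j = 1 \<and> x $ i = 1 \<and> x $ j = 1) \<longleftrightarrow>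
    B $ k $ l = 1 \<and> x $ k = 1 \<and> x $ l = 1"
  using assms Bmats_sym[OF assms(1)] by (auto simp: doubleton_eq_iff)

lemma Bmats_add: "B \<in> Bmats \<Longrightarrow> C \<in> Bmats \<Longrightarrow> B + C \<in> Bmats"
  by (auto simp: Bmats_def transpose_def vec_eq_iff)

text \<open>Adding two bits modulo 4 gives their sum modulo 2 plus a carry: \<open>\<i>\<close> to
  the powers \<open>b $ i\<close> and \<open>c $ i\<close> multiplies to \<open>-1\<close> exactly
  when both bits are one. The carry \<open>b $ i * c $ i\<close> moves into the Z parameter; the
  other parameters add over the field.\<close>

lemma normal_phase_mult:
  fixes B :: "bit^'n^'n"
  assumes "B \<in> Bmats" "C \<in> Bmats"
  shows "normal_phase v b B x * normal_phase w c C x =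
    normal_phase (v + w + (\<chi> i. b $ i * c $ i)) (b + c) (B + C) x"
proof -
  let ?e = "\<lambda>a (v::bit^'n). a ^ card {i. v $ i = 1 \<and> x $ i = 1} :: complex"
  let ?q = "\<lambda>B. (-1) ^ card {p. \<exists>i j. p = {i, j} \<and> i \<noteq> j \<and> B $ i $ j = 1 \<and> x $ i = 1 \<and> x $ j = 1} :: complex"
  have z: "?e (-1) v * ?e (-1) w = ?e (-1) (v + w)" for v w
    unfolding power_card_Collect prod.distrib[symmetric]
  proof (rule prod.cong)
    show "(if v $ i = 1 \<and> x $ i = 1 then -1 else 1) * (if w $ i = 1 \<and> x $ i = 1 then -1 else 1) =
      (if (v + w) $ i = 1 \<and> x $ i = 1 then -1 else 1 :: complex)" for i
      by (cases "v $ i"; cases "w $ i") simp_all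
  qed simp
  have p: "?e \<i> b * ?e \<i> c = ?e (-1) (\<chi> i. b $ i * c $ i) * ?e \<i> (b + c)"
    unfolding power_card_Collect prod.distrib[symmetric]
  proof (rule prod.cong)
    show "(if b $ i = 1 \<and> x $ i = 1 then \<i> else 1) * (if c $ i = 1 \<and> x $ i = 1 then \<i> else 1) =
      (if (\<chi> i. b $ i * c $ i) $ i = 1 \<and> x $ i = 1 then -1 else 1) *
      (if (b + c) $ i = 1 \<and> x $ i = 1 then \<i> else 1)" for i
      by (cases "b $ i"; cases "c $ i") simp_all
  qed simp
  have q: "?q B * ?q C = ?q (B + C)"
    unfolding power_card_Collect prod.distrib[symmetric]
  proof (rule prod.cong)
    fix p
    let ?c = "\<lambda>B. \<exists>i j. p = {i, j} \<and> i \<noteq> j \<and> B $ i $ j = 1 \<and> x $ i = 1 \<and> x $ j = 1"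
    show "(if ?c B then -1 else 1) * (if ?c C then -1 else 1) = (if ?c (B + C) then -1 else 1 :: complex)"
    proof (cases "\<exists>k l. p = {k, l} \<and> k \<noteq> l")
      case True
      then obtain k l where kl: "p = {k, l}" "k \<noteq> l" by blast
      show ?thesis
        unfolding kl(1) Bmats_pair[OF assms(1) kl(2)] Bmats_pair[OF assms(2) kl(2)]
          Bmats_pair[OF Bmats_add[OF assms] kl(2)]
        by (cases "B $ k $ l"; cases "C $ k $ l") simp_all
    next
      case False
      then have "\<not> ?c B" for B :: "bit^'n^'n" by blast
      then show ?thesis by (simp only: if_False) simp
    qed
  qed simp
  have "normal_phase v b B x * normal_phase w c C x =
      (?e (-1) v * ?e (-1) w) * (?e \<i> b * ?e \<i> c) * (?q B * ?q C)"
    by (simp only: normal_phase_def mult_ac)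
  also have "\<dots> = ?e (-1) (v + w) * (?e (-1) (\<chi> i. b $ i * c $ i) * ?e \<i> (b + c)) * ?q (B + C)"
    unfolding z p q ..
  also have "\<dots> = (?e (-1) (v + w) * ?e (-1) (\<chi> i. b $ i * c $ i)) * ?e \<i> (b + c) * ?q (B + C)"
    by (simp only: mult.assoc)
  also have "\<dots> = normal_phase (v + w + (\<chi> i. b $ i * c $ i)) (b + c) (B + C) x"
    unfolding z normal_phase_def ..
  finally show ?thesis .
qed

lemma Bmats_0: "0 \<in> Bmats"
  by (simp add: Bmats_def transpose_def vec_eq_iff)

lemma CZ_in_Bmats:
  "i \<noteq> j \<Longrightarrow> (\<chi> k l. if (k = i \<and> l = j) \<or> (k = j \<and> l = i) then 1 else 0) \<in> Bmats"
  by (auto simp: Bmats_def transpose_def vec_eq_iff)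

lemma CZ_exponent:
  assumes "i \<noteq> j"
  shows "(-1) ^ card {p. \<exists>k l. p = {k, l} \<and> k \<noteq> l \<and>
      (\<chi> k l. if (k = i \<and> l = j) \<or> (k = j \<and> l = i) then 1 else 0) $ k $ l = (1::bit) \<and> x $ k = 1 \<and> x $ l = 1} =
    (if x $ i = 1 \<and> x $ j = 1 then -1 else 1 :: complex)" (is "_ ^ card ?S = _")
proof -
  have "?S = (if x $ i = 1 \<and> x $ j = 1 then {{i, j}} else {})"
    using assms by (auto split: if_splits)
  then show ?thesis by simp
qed

lemma phase_imp_normal:
  fixes f :: "bit^'n \<Rightarrow> complex"
  shows "f \<in> phase \<Longrightarrow> \<exists>v b. \<exists>B \<in> Bmats. f = normal_phase v b B"
proof (induction rule: phase.induct)
  case one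
  have "(\<lambda>_. 1) = normal_phase 0 0 (0 :: bit^'n^'n)"
    by (simp add: fun_eq_iff normal_phase_def)
  then show ?case using Bmats_0 by blast
next
  case (P k)
  have "(if x $ k = 1 then \<i> else 1) = normal_phase 0 (axis k 1) 0 x" for x :: "bit^'n"
  proof -
    have "{i. axis k (1::bit) $ i = 1 \<and> x $ i = 1} = (if x $ k = 1 then {k} else {})"
      by (auto simp: axis_def)
    then show ?thesis by (simp add: normal_phase_def)
  qed
  then show ?case using Bmats_0 by blast
next
  case (CZ i j)
  have "(if x $ i = 1 \<and> x $ j = 1 then -1 else 1) = normal_phase 0 0
      (\<chi> k l. if (k = i \<and> l = j) \<or> (k = j \<and> l = i) then 1 else 0) x" for x :: "bit^'n"
    unfolding normal_phase_def CZ_exponent[OF CZ] by simp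
  then show ?case using CZ_in_Bmats[OF CZ] by blast
next
  case (mult f g)
  then show ?case using normal_phase_mult Bmats_add by (metis (no_types, lifting) ext)
qed

lemma normal_phase_in_phase:
  fixes B :: "bit^'n^'n"
  shows "normal_phase v b B \<in> phase"
proof -
  have "(\<lambda>x. (\<Prod>i\<in>UNIV. if v $ i = 1 \<and> x $ i = 1 then -1 else 1) *
      (\<Prod>i\<in>UNIV. if b $ i = 1 \<and> x $ i = 1 then \<i> else 1) *
      (\<Prod>p\<in>UNIV. if \<exists>i j. p = {i, j} \<and> i \<noteq> j \<and> B $ i $ j = 1 \<and> x $ i = 1 \<and> x $ j = 1 then -1 else 1))
    \<in> phase"
  proof (intro phase.mult phase_prod)
    show "(\<lambda>x. if v $ i = 1 \<and> x $ i = 1 then -1 else 1) \<in> phase" for i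
      by (cases "v $ i = 1") (simp_all add: phase_Z phase.one)
    show "(\<lambda>x. if b $ i = 1 \<and> x $ i = 1 then \<i> else 1) \<in> phase" for i
      by (cases "b $ i = 1") (simp_all add: phase.intros)
    fix p :: "'n set"
    show "(\<lambda>x :: bit^'n. if \<exists>i j. p = {i, j} \<and> i \<noteq> j \<and> B $ i $ j = 1 \<and> x $ i = 1 \<and> x $ j = 1
        then -1 else 1) \<in> phase"
    \<comment> \<open>Only a pair \<open>p = {k, l}\<close> with \<open>B $ k $ l = 1\<close> gives
      a factor depending on \<open>x\<close>; for any other set \<open>p\<close> the factor is
      constantly one.\<close>
    proof (cases "\<exists>k l. p = {k, l} \<and> k \<noteq> l \<and> B $ k $ l = 1")
      case True
      then obtain k l where kl: "p = {k, l}" "k \<noteq> l" "B $ k $ l = 1" by blast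
      then have "(\<exists>i j. p = {i, j} \<and> i \<noteq> j \<and> B $ i $ j = 1 \<and> x $ i = 1 \<and> x $ j = 1) \<longleftrightarrow>
          x $ k = 1 \<and> x $ l = 1" for x :: "bit^'n"
        by (auto simp: doubleton_eq_iff)
      then show ?thesis using phase.CZ[OF kl(2)] by simp
    next
      case False
      then have "\<not> (\<exists>i j. p = {i, j} \<and> i \<noteq> j \<and> B $ i $ j = 1 \<and> x $ i = 1 \<and> x $ j = 1)"
        for x :: "bit^'n" by blast
      then show ?thesis using phase.one by (simp only: if_False)
    qed
  qed simp_all
  also have "(\<lambda>x. (\<Prod>i\<in>UNIV. if v $ i = 1 \<and> x $ i = 1 then -1 else 1) *
      (\<Prod>i\<in>UNIV. if b $ i = 1 \<and> x $ i = 1 then \<i> else 1) *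
      (\<Prod>p\<in>UNIV. if \<exists>i j. p = {i, j} \<and> i \<noteq> j \<and> B $ i $ j = 1 \<and> x $ i = 1 \<and> x $ j = 1 then -1 else 1))
    = normal_phase v b B"
    unfolding normal_phase_def power_card_Collect ..
  finally show ?thesis .
qed

text \<open>A weight one vector contains no pair, so the quadratic factor is trivial. The four
  possible values are the distinct fourth roots of unity and determine both bits at
  \<open>k\<close>.\<close>

lemma normal_phase_axis:
  fixes B :: "bit^'n^'n"
  shows "normal_phase v b B (axis k 1) = (if v $ k = 1 then -1 else 1) * (if b $ k = 1 then \<i> else 1)"
proof -
  have *: "{i. v $ i = 1 \<and> axis k (1::bit) $ i = 1} = (if v $ k = 1 then {k} else {})" for v :: "bit^'n"
    by (auto simp: axis_def)
  have **: "{p. \<exists>i j. p = {i, j} \<and> i \<noteq> j \<and> B $ i $ j = 1 \<and> axis k (1::bit) $ i = 1 \<and> axis k (1::bit) $ j = 1} = {}"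
    by (auto simp: axis_def split: if_splits)
  show ?thesis unfolding normal_phase_def * ** by simp
qed

lemma normal_phase_inj:
  fixes B :: "bit^'n^'n"
  assumes "B \<in> Bmats" "C \<in> Bmats" "normal_phase v b B = normal_phase w c C"
  shows "v = w \<and> b = c \<and> B = C"
proof -
  have "v $ k = w $ k \<and> b $ k = c $ k" for k
    using fun_cong[OF assms(3), of "axis k 1"] unfolding normal_phase_axis
    by (cases "v $ k"; cases "w $ k"; cases "b $ k"; cases "c $ k") (simp_all add: complex_eq_iff)
  then have vb: "v = w" "b = c" by (simp_all add: vec_eq_iff)
  have "B $ k $ l = C $ k $ l" for k l
  proof (cases "k = l")
    case True
    then show ?thesis using assms by (simp add: Bmats_def)
  next
    case False
    \<comment> \<open>The linear parameters are already known to agree, so their factors cancel at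
      this vector, whose support contains \<open>{k, l}\<close> as its only pair.\<close>
    let ?x = "axis k 1 + axis l 1 :: bit^'n"
    have x: "?x $ i = 1 \<longleftrightarrow> i = k \<or> i = l" for i
      using False by (auto simp: axis_def)
    have q: "{p. \<exists>i j. p = {i, j} \<and> i \<noteq> j \<and> D $ i $ j = 1 \<and> ?x $ i = 1 \<and> ?x $ j = 1} =
        (if D $ k $ l = 1 then {{k, l}} else {})" if "D \<in> Bmats" for D
      unfolding x using False Bmats_sym[OF that] by (auto simp: insert_commute)
    have "(-1) ^ card (if B $ k $ l = 1 then {{k, l}} else {}) =
        ((-1) ^ card (if C $ k $ l = 1 then {{k, l}} else {}) :: complex)"
      using fun_cong[OF assms(3), of ?x]
      unfolding normal_phase_def vb q[OF assms(1)] q[OF assms(2)] by simp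
    then show ?thesis by (cases "B $ k $ l"; cases "C $ k $ l") simp_all
  qed
  then show ?thesis using vb by (simp add: vec_eq_iff)
qed

text \<open>These are the adjacency matrices of simple graphs on the qubits; they correspond to
  arbitrary sets of two-element subsets.\<close>

lemma card_Bmats: "card (Bmats :: (bit^'n^'n) set) = 2 ^ (CARD('n) choose 2)"
proof -
  have "bij_betw (\<lambda>B. {p. \<exists>i j. p = {i, j} \<and> i \<noteq> j \<and> B $ i $ j = 1}) (Bmats :: (bit^'n^'n) set)
      (Pow {p. card p = 2})"
  proof (rule bij_betw_byWitness[where f' = "\<lambda>E. \<chi> i j. if i \<noteq> j \<and> {i, j} \<in> E then 1 else 0"])
    show "\<forall>B\<in>(Bmats :: (bit^'n^'n) set). (\<chi> i j. if i \<noteq> j \<and> {i, j} \<in> {p. \<exists>i j. p = {i, j} \<and> i \<noteq> j \<and> B $ i $ j = 1}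
        then 1 else 0) = B"
    proof
      fix B :: "bit^'n^'n" assume B: "B \<in> Bmats"
      have "(if k \<noteq> l \<and> (\<exists>i j. {k, l} = {i, j} \<and> i \<noteq> j \<and> B $ i $ j = 1) then 1 else 0) = B $ k $ l" for k l
      proof (cases "k = l")
        case True
        then show ?thesis using B by (simp add: Bmats_def)
      next
        case False
        then have "(\<exists>i j. {k, l} = {i, j} \<and> i \<noteq> j \<and> B $ i $ j = 1) \<longleftrightarrow> B $ k $ l = 1"
          using Bmats_sym[OF B, of k l] by (auto simp: doubleton_eq_iff)
        then show ?thesis using False by (cases "B $ k $ l") simp_all
      qed
      then show "(\<chi> i j. if i \<noteq> j \<and> {i, j} \<in> {p. \<exists>i j. p = {i, j} \<and> i \<noteq> j \<and> B $ i $ j = 1}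
        then 1 else 0) = B"
        by (simp only: vec_eq_iff vec_lambda_beta mem_Collect_eq simp_thms)
    qed
    show "\<forall>E\<in>Pow {p :: 'n set. card p = 2}. {p. \<exists>i j. p = {i, j} \<and> i \<noteq> j \<and>
        (\<chi> i j. if i \<noteq> j \<and> {i, j} \<in> E then 1 else 0) $ i $ j = (1::bit)} = E"
    proof
      fix E :: "'n set set" assume E: "E \<in> Pow {p. card p = 2}"
      have "(\<exists>i j. p = {i, j} \<and> i \<noteq> j \<and> (if i \<noteq> j \<and> {i, j} \<in> E then 1 else 0) = (1::bit)) \<longleftrightarrow> p \<in> E" for p
      proof
        assume "p \<in> E"
        moreover then obtain i j where "p = {i, j}" "i \<noteq> j" using E by (auto simp: card_2_iff)
        ultimately show "\<exists>i j. p = {i, j} \<and> i \<noteq> j \<and> (if i \<noteq> j \<and> {i, j} \<in> E then 1 else 0) = (1::bit)"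
          by metis
      qed (auto split: if_splits)
      then show "{p. \<exists>i j. p = {i, j} \<and> i \<noteq> j \<and>
          (\<chi> i j. if i \<noteq> j \<and> {i, j} \<in> E then 1 else 0) $ i $ j = (1::bit)} = E"
        unfolding vec_lambda_beta by blast
    qed
  qed (auto simp: card_2_iff Bmats_def transpose_def insert_commute vec_eq_iff)
  then have "card (Bmats :: (bit^'n^'n) set) = card (Pow {p :: 'n set. card p = 2})"
    by (rule bij_betw_same_card)
  also have "\<dots> = 2 ^ (CARD('n) choose 2)"
    using n_subsets[of "UNIV :: 'n set" 2] by (simp add: card_Pow)
  finally show ?thesis .
qed

section \<open>The groups of operators\<close>

lemma diag_op_mult_left: "(diag_op f ** M) $ y $ x = f y * M $ y $ x"
  by (simp add: matrix_matrix_mult_def diag_op_def if_distrib[of "\<lambda>a. a * b" for b] cong: if_cong)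

lemma diag_op_mult_right: "(M ** diag_op f) $ y $ x = M $ y $ x * f x"
  by (simp add: matrix_matrix_mult_def diag_op_def if_distrib[of "\<lambda>a. b * a" for b] cong: if_cong)

lemma diag_op_mult: "diag_op f ** diag_op g = diag_op (\<lambda>x. f x * g x)"
  by (simp add: vec_eq_iff diag_op_mult_left) (simp add: diag_op_def)

lemma diag_op_one: "diag_op (\<lambda>_. 1) = mat 1"
  by (simp add: diag_op_def mat_def vec_eq_iff)

lemma X_mat_mult: "X_mat A ** X_mat B = X_mat (A ** B)"
proof -
  have "(X_mat A ** X_mat B) $ y $ x = X_mat (A ** B) $ y $ x" for y x
  proof -
    have "(X_mat A ** X_mat B) $ y $ x = (\<Sum>z\<in>UNIV. if z = B *v x then if y = A *v z then 1 else 0 else 0)"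
      unfolding matrix_matrix_mult_def X_mat_def vec_lambda_beta
      by (rule sum.cong) auto
    also have "\<dots> = X_mat (A ** B) $ y $ x"
      by (simp add: X_mat_def matrix_vector_mul_assoc)
    finally show ?thesis .
  qed
  then show ?thesis by (simp add: vec_eq_iff)
qed

lemma X_mat_one: "X_mat (mat 1) = mat 1"
  by (simp add: X_mat_def) (simp add: mat_def)

lemma inverse_mat_vec_eq_iff:
  fixes A A' :: "'a :: semiring_1^'n^'n"
  assumes "A ** A' = mat 1" "A' ** A = mat 1"
  shows "y = A *v x \<longleftrightarrow> x = A' *v y"
  using assms by (auto simp: matrix_vector_mul_assoc)

text \<open>Both sides send the basis state of \<open>x\<close> to \<open>f x\<close> times that of
  \<open>A *v x\<close>. This commutation rule underlies closure under products and adjoints as well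
  as normality.\<close>

lemma X_mat_diag_op:
  assumes "A ** A' = mat 1" "A' ** A = mat 1"
  shows "X_mat A ** diag_op f = diag_op (\<lambda>y. f (A' *v y)) ** X_mat A"
proof -
  have "(X_mat A ** diag_op f) $ y $ x = (diag_op (\<lambda>y. f (A' *v y)) ** X_mat A) $ y $ x" for y x
  proof (cases "y = A *v x")
    case True
    then show ?thesis
      by (simp add: diag_op_mult_left diag_op_mult_right matrix_vector_mul_assoc assms)
  next
    case False
    then show ?thesis by (simp add: diag_op_mult_left diag_op_mult_right X_mat_def)
  qed
  then show ?thesis by (simp add: vec_eq_iff)
qed

lemma adjoint_diag_op: "adjoint (diag_op f) = diag_op (\<lambda>x. cnj (f x))"
  by (auto simp: adjoint_def diag_op_def vec_eq_iff)

lemma adjoint_X_mat: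
  assumes "A ** A' = mat 1" "A' ** A = mat 1"
  shows "adjoint (X_mat A) = X_mat A'"
  using inverse_mat_vec_eq_iff[OF assms] by (auto simp: adjoint_def X_mat_def vec_eq_iff)

lemma adjoint_mult: "adjoint (U ** V) = adjoint V ** adjoint U"
  by (simp add: adjoint_def matrix_matrix_mult_def vec_eq_iff mult.commute)

lemma adjoint_adjoint: "adjoint (adjoint U) = U"
  by (simp add: adjoint_def vec_eq_iff)

lemma adjoint_one: "adjoint (mat 1) = mat 1"
  by (auto simp: adjoint_def mat_def vec_eq_iff)

lemma unitary_group_simps [simp]:
  "U \<in> carrier unitary_group \<longleftrightarrow> U ** adjoint U = mat 1 \<and> adjoint U ** U = mat 1"
  "U \<otimes>\<^bsub>unitary_group\<^esub> V = U ** V"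
  "\<one>\<^bsub>unitary_group\<^esub> = mat 1"
  by (simp_all add: unitary_group_def)

lemma unitary_mult:
  assumes "U \<in> carrier unitary_group" "V \<in> carrier unitary_group"
  shows "U ** V \<in> carrier unitary_group"
proof -
  have "(U ** V) ** adjoint (U ** V) = U ** (V ** adjoint V) ** adjoint U"
    "adjoint (U ** V) ** (U ** V) = adjoint V ** (adjoint U ** U) ** V"
    by (simp_all add: adjoint_mult matrix_mul_assoc)
  then show ?thesis using assms by simp
qed

lemma group_unitary_group: "group unitary_group"
proof (rule groupI)
  fix U :: "complex^'m^'m" assume "U \<in> carrier unitary_group"
  then show "\<exists>V\<in>carrier unitary_group. V \<otimes>\<^bsub>unitary_group\<^esub> U = \<one>\<^bsub>unitary_group\<^esub>"
    by (intro bexI[of _ "adjoint U"]) (simp_all add: adjoint_adjoint)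
next
  fix U V :: "complex^'m^'m"
  assume "U \<in> carrier unitary_group" "V \<in> carrier unitary_group"
  then show "U \<otimes>\<^bsub>unitary_group\<^esub> V \<in> carrier unitary_group"
    using unitary_mult by (simp only: unitary_group_simps)
qed (simp_all add: adjoint_one matrix_mul_assoc)

interpretation U: group unitary_group
  by (rule group_unitary_group)

lemma inv_unitary_group: "U \<in> carrier unitary_group \<Longrightarrow> inv\<^bsub>unitary_group\<^esub> U = adjoint U"
  by (rule U.inv_equality) (simp_all add: adjoint_adjoint)

lemma diag_phase_unitary:
  assumes "f \<in> phase"
  shows "diag_op f \<in> carrier unitary_group"
proof -
  have "f x * cnj (f x) = 1" for x
    using phase_norm[OF assms, of x] by (simp add: complex_norm_square[symmetric])
  then show ?thesis
    by (simp add: adjoint_diag_op diag_op_mult diag_op_one mult.commute)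
qed

lemma X_mat_unitary:
  assumes "invertible A"
  shows "X_mat A \<in> carrier unitary_group"
proof -
  obtain A' where A': "A ** A' = mat 1" "A' ** A = mat 1"
    using assms by (auto simp: invertible_def)
  then show ?thesis by (simp add: adjoint_X_mat[OF A'] X_mat_mult X_mat_one)
qed

section \<open>An explicit model of the full group\<close>

definition phase_linear_ops :: "(complex^(bit^'n)^(bit^'n)) set" where
  "phase_linear_ops = {diag_op f ** X_mat A | f A. f \<in> phase \<and> invertible A}"

lemma phase_linear_opsI: "f \<in> phase \<Longrightarrow> invertible A \<Longrightarrow> diag_op f ** X_mat A \<in> phase_linear_ops"
  by (auto simp: phase_linear_ops_def)

text \<open>The second diagonal is moved left past \<open>X_mat A\<close>, which composes it with
  the inverse of \<open>A\<close>: the multiplication rule of a semidirect product.\<close>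

lemma phase_linear_ops_mult:
  assumes "g \<in> phase_linear_ops" "h \<in> phase_linear_ops"
  shows "g ** h \<in> phase_linear_ops"
proof -
  obtain f1 A f2 B where *: "g = diag_op f1 ** X_mat A" "h = diag_op f2 ** X_mat B"
    "f1 \<in> phase" "f2 \<in> phase" "invertible A" "invertible B"
    using assms by (auto simp: phase_linear_ops_def)
  obtain A' where A': "A ** A' = mat 1" "A' ** A = mat 1"
    using * by (auto simp: invertible_def)
  then have "invertible A'" by (auto simp: invertible_def)
  have "g ** h = diag_op f1 ** (X_mat A ** diag_op f2) ** X_mat B"
    by (simp add: * matrix_mul_assoc)
  also have "\<dots> = (diag_op f1 ** diag_op (\<lambda>y. f2 (A' *v y))) ** (X_mat A ** X_mat B)"
    by (simp add: X_mat_diag_op[OF A'] matrix_mul_assoc)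
  also have "\<dots> = diag_op (\<lambda>y. f1 y * f2 (A' *v y)) ** X_mat (A ** B)"
    by (simp add: diag_op_mult X_mat_mult)
  also have "\<dots> \<in> phase_linear_ops"
    using * \<open>invertible A'\<close>
    by (intro phase_linear_opsI phase.mult phase_linear_subst invertible_mult)
  finally show ?thesis .
qed

lemma phase_linear_ops_adjoint:
  assumes "g \<in> phase_linear_ops"
  shows "adjoint g \<in> phase_linear_ops"
proof -
  obtain f A where *: "g = diag_op f ** X_mat A" "f \<in> phase" "invertible A"
    using assms by (auto simp: phase_linear_ops_def)
  obtain A' where A': "A ** A' = mat 1" "A' ** A = mat 1"
    using * by (auto simp: invertible_def)
  then have "invertible A'" by (auto simp: invertible_def)
  have "adjoint g = X_mat A' ** diag_op (\<lambda>x. cnj (f x))"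
    by (simp add: * adjoint_mult adjoint_X_mat[OF A'] adjoint_diag_op)
  \<comment> \<open>The adjoint reverses the factors; the commutation rule, with \<open>A\<close>
    and \<open>A'\<close> exchanged, restores the diagonal to the left.\<close>
  also have "\<dots> = diag_op (\<lambda>x. cnj (f (A *v x))) ** X_mat A'"
    by (rule X_mat_diag_op[OF A'(2,1)])
  also have "\<dots> \<in> phase_linear_ops"
    using * \<open>invertible A'\<close> by (intro phase_linear_opsI phase_cnj phase_linear_subst)
  finally show ?thesis .
qed

lemma phase_linear_ops_unitary: "phase_linear_ops \<subseteq> carrier unitary_group"
proof
  fix g :: "complex^(bit^'n)^(bit^'n)" assume "g \<in> phase_linear_ops"
  then show "g \<in> carrier unitary_group"
    unfolding phase_linear_ops_def using unitary_mult diag_phase_unitary X_mat_unitary by blast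
qed

lemma subgroup_unitaryI:
  assumes "H \<subseteq> carrier unitary_group" "mat 1 \<in> H"
    "\<And>g. g \<in> H \<Longrightarrow> adjoint g \<in> H" "\<And>g h. g \<in> H \<Longrightarrow> h \<in> H \<Longrightarrow> g ** h \<in> H"
  shows "subgroup H unitary_group"
proof (rule U.subgroupI)
  show "inv\<^bsub>unitary_group\<^esub> g \<in> H" if "g \<in> H" for g
    using inv_unitary_group assms that by (metis subsetD)
qed (use assms in auto)

lemma invertible_mat_1: "invertible (mat 1 :: bit^'n^'n)"
  using transvections_invertible transvections.one by blast

lemma subgroup_phase_linear_ops: "subgroup phase_linear_ops unitary_group"
proof (rule subgroup_unitaryI[OF phase_linear_ops_unitary])
  show "mat 1 \<in> phase_linear_ops"
    using phase_linear_opsI[OF phase.one invertible_mat_1]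
    by (simp add: diag_op_one X_mat_one)
qed (simp_all add: phase_linear_ops_adjoint phase_linear_ops_mult)

lemma subgroup_diag_phase:
  "subgroup (diag_op ` phase :: (complex^(bit^'n)^(bit^'n)) set) unitary_group"
proof (rule subgroup_unitaryI)
  show "diag_op ` phase \<subseteq> carrier unitary_group"
    using diag_phase_unitary by blast
  show "mat 1 \<in> diag_op ` phase"
    using phase.one diag_op_one by (metis imageI)
  show "adjoint g \<in> diag_op ` phase" if "g \<in> diag_op ` phase" for g :: "complex^(bit^'n)^(bit^'n)"
    using that by (auto simp: adjoint_diag_op intro: phase_cnj)
  show "g ** h \<in> diag_op ` phase" if "g \<in> diag_op ` phase" "h \<in> diag_op ` phase" for g h :: "complex^(bit^'n)^(bit^'n)"
    using that by (auto simp: diag_op_mult intro: phase.mult)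
qed

lemma subgroup_X_mats:
  "subgroup (X_mat ` {A. invertible A} :: (complex^(bit^'n)^(bit^'n)) set) unitary_group"
proof (rule subgroup_unitaryI)
  show "X_mat ` {A. invertible A} \<subseteq> carrier unitary_group"
    using X_mat_unitary by blast
  show "mat 1 \<in> X_mat ` {A. invertible A}"
    using X_mat_one invertible_mat_1 by (metis imageI mem_Collect_eq)
  show "adjoint g \<in> X_mat ` {A. invertible A}" if g: "g \<in> X_mat ` {A. invertible A}" for g :: "complex^(bit^'n)^(bit^'n)"
  proof -
    obtain A where A: "g = X_mat A" "invertible A" using g by blast
    then obtain A' where A': "A ** A' = mat 1" "A' ** A = mat 1"
      by (auto simp: invertible_def)
    then have "adjoint g = X_mat A'" "invertible A'"
      by (auto simp: A adjoint_X_mat[OF A'] invertible_def)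
    then show ?thesis by simp
  qed
  show "g ** h \<in> X_mat ` {A. invertible A}"
    if "g \<in> X_mat ` {A. invertible A}" "h \<in> X_mat ` {A. invertible A}" for g h :: "complex^(bit^'n)^(bit^'n)"
    using that by (auto simp: X_mat_mult intro: invertible_mult)
qed

section \<open>Identification of the generated groups\<close>

lemma CZ_gate_eq:
  assumes "i \<noteq> j"
  shows "CZ_gate i j = diag_op (\<lambda>x. if x $ i = 1 \<and> x $ j = 1 then -1 else 1)"
  unfolding CZ_gate_def Z_mat_def CZ_exponent[OF assms] ..

lemma N_grp_eq: "N_grp = diag_op ` phase"
proof
  have "N_gens \<subseteq> diag_op ` phase"
    by (auto simp: N_gens_def P_gate_def CZ_gate_eq intro: phase.intros)
  then show "N_grp \<subseteq> diag_op ` phase"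
    unfolding N_grp_def by (rule U.generate_subgroup_incl[OF _ subgroup_diag_phase])
  have "diag_op f \<in> N_grp" if "f \<in> phase" for f :: "bit^'n \<Rightarrow> complex"
    using that
  proof (induction rule: phase.induct)
    case one
    show ?case unfolding N_grp_def diag_op_one
      using generate.one[of unitary_group] by simp
  next
    case (P i)
    have "P_gate i \<in> N_grp" unfolding N_grp_def by (rule generate.incl) (simp add: N_gens_def)
    then show ?case by (simp only: P_gate_def)
  next
    case (CZ i j)
    then have "CZ_gate i j \<in> N_grp"
      unfolding N_grp_def by (intro generate.incl) (auto simp: N_gens_def)
    then show ?case by (simp only: CZ_gate_eq[OF CZ])
  next
    case (mult f g)
    then show ?case
      using generate.eng[of _ unitary_group] unfolding N_grp_def by (simp flip: diag_op_mult)
  qed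
  then show "diag_op ` phase \<subseteq> (N_grp :: (complex^(bit^'n)^(bit^'n)) set)" by blast
qed

text \<open>A CNOT is the operator of an elementary transvection, so the inclusion from right to
  left is Gaussian elimination.\<close>

lemma X_grp_eq: "X_grp = X_mat ` {A. invertible A}"
proof
  have "X_gens \<subseteq> X_mat ` {A. invertible A}"
    by (auto simp: X_gens_def CNOT_gate_def intro: transvections_invertible transvections.elementary)
  then show "X_grp \<subseteq> X_mat ` {A. invertible A}"
    unfolding X_grp_def by (rule U.generate_subgroup_incl[OF _ subgroup_X_mats])
  have "X_mat A \<in> X_grp" if "A \<in> transvections" for A :: "bit^'n^'n"
    using that
  proof (induction rule: transvections.induct)
    case one
    show ?case unfolding X_grp_def X_mat_one
      using generate.one[of unitary_group] by simp
  next
    case (elementary i j)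
    then have "CNOT_gate i j \<in> X_grp"
      unfolding X_grp_def by (intro generate.incl) (auto simp: X_gens_def)
    then show ?case by (simp only: CNOT_gate_def)
  next
    case (mult A B)
    then show ?case
      using generate.eng[of _ unitary_group] unfolding X_grp_def by (simp flip: X_mat_mult)
  qed
  then show "X_mat ` {A. invertible A} \<subseteq> (X_grp :: (complex^(bit^'n)^(bit^'n)) set)"
    using invertible_imp_transvections by blast
qed

lemma G_grp_eq: "G_grp = phase_linear_ops"
proof
  have N: "diag_op f \<in> phase_linear_ops" if "f \<in> phase" for f :: "bit^'n \<Rightarrow> complex"
    using phase_linear_opsI[OF that invertible_mat_1] by (simp add: X_mat_one)
  have X: "X_mat A \<in> phase_linear_ops" if "invertible A" for A :: "bit^'n^'n"
    using phase_linear_opsI[OF phase.one that] by (simp add: diag_op_one)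
  have gens: "N_gens \<subseteq> (N_grp :: (complex^(bit^'n)^(bit^'n)) set)"
    "X_gens \<subseteq> (X_grp :: (complex^(bit^'n)^(bit^'n)) set)"
    unfolding N_grp_def X_grp_def by (auto intro: generate.incl)
  have "N_gens \<union> X_gens \<subseteq> (phase_linear_ops :: (complex^(bit^'n)^(bit^'n)) set)"
    using gens N X unfolding N_grp_eq X_grp_eq by blast
  then show "G_grp \<subseteq> (phase_linear_ops :: (complex^(bit^'n)^(bit^'n)) set)"
    unfolding G_grp_def by (rule U.generate_subgroup_incl[OF _ subgroup_phase_linear_ops])
  have sub: "N_grp \<subseteq> G_grp" "X_grp \<subseteq> G_grp"
    unfolding N_grp_def X_grp_def G_grp_def by (rule U.mono_generate, blast)+
  show "phase_linear_ops \<subseteq> (G_grp :: (complex^(bit^'n)^(bit^'n)) set)"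
  proof
    fix g :: "complex^(bit^'n)^(bit^'n)" assume "g \<in> phase_linear_ops"
    then obtain f A where g: "g = diag_op f ** X_mat A" "f \<in> phase" "invertible A"
      by (auto simp: phase_linear_ops_def)
    then have "diag_op f \<in> G_grp" "X_mat A \<in> G_grp"
      using sub unfolding N_grp_eq X_grp_eq by auto
    then show "g \<in> G_grp"
      unfolding g(1) G_grp_def using generate.eng[of _ unitary_group] by simp
  qed
qed

text \<open>The positions of the nonzero entries reveal the matrix, since phases never vanish; the
  entries themselves then reveal the diagonal, because every vector has the form
  \<open>A *v x\<close>.\<close>

lemma diag_X_mat_inj:
  assumes "diag_op f ** X_mat A = diag_op g ** X_mat B" "f \<in> phase" "invertible A"
  shows "f = g \<and> A = B"
proof -
  have *: "A *v x = B *v x \<and> f (A *v x) = g (A *v x)" for x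
  proof -
    have "f (A *v x) = g (A *v x) * (if A *v x = B *v x then 1 else 0)"
      using arg_cong[OF assms(1), of "\<lambda>M. M $ (A *v x) $ x"]
      by (simp add: diag_op_mult_left X_mat_def split: if_splits)
    moreover have "f (A *v x) \<noteq> 0"
      using phase_norm[OF assms(2), of "A *v x"] by auto
    ultimately show ?thesis by (auto split: if_splits)
  qed
  obtain A' where A': "A ** A' = mat 1" using assms(3) by (auto simp: invertible_def)
  have "f x = g x" for x
    using *[of "A' *v x"] by (simp add: matrix_vector_mul_assoc A')
  then show ?thesis using * by (auto simp: matrix_eq)
qed

lemma normal_form_op: "Z_vec v ** P_vec b ** Z_mat B = diag_op (normal_phase v b B)"
  by (simp add: Z_vec_def P_vec_def Z_mat_def diag_op_mult normal_phase_def[abs_def])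

text \<open>The source of normality: the permutation parts cancel after the commutation rule, and
  only a product of phases remains on the diagonal.\<close>

lemma phase_linear_ops_conj:
  assumes "g \<in> phase_linear_ops" "f \<in> phase"
  shows "g ** diag_op f ** adjoint g \<in> diag_op ` phase"
proof -
  obtain h A where g: "g = diag_op h ** X_mat A" "h \<in> phase" "invertible A"
    using assms by (auto simp: phase_linear_ops_def)
  obtain A' where A': "A ** A' = mat 1" "A' ** A = mat 1"
    using g by (auto simp: invertible_def)
  then have "invertible A'" by (auto simp: invertible_def)
  have "g ** diag_op f ** adjoint g =
      diag_op h ** (X_mat A ** diag_op f) ** X_mat A' ** diag_op (\<lambda>x. cnj (h x))"
    by (simp add: g adjoint_mult adjoint_X_mat[OF A'] adjoint_diag_op matrix_mul_assoc)
  also have "\<dots> = diag_op h ** diag_op (\<lambda>y. f (A' *v y)) ** (X_mat A ** X_mat A') ** diag_op (\<lambda>x. cnj (h x))"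
    by (simp only: X_mat_diag_op[OF A'] matrix_mul_assoc)
  also have "\<dots> = diag_op (\<lambda>x. h x * f (A' *v x) * cnj (h x))"
    by (simp add: X_mat_mult A' X_mat_one diag_op_mult)
  finally show ?thesis
    using g assms \<open>invertible A'\<close> by (auto intro!: imageI phase.mult phase_cnj phase_linear_subst)
qed

theorem theorem3p2:
  fixes G N X :: "(complex^(bit^'n::finite)^(bit^'n)) set"
  defines "G \<equiv> G_grp" and "N \<equiv> N_grp" and "X \<equiv> X_grp"
  shows "(\<forall>g \<in> G. \<exists>!(v, b, B, A). B \<in> Bmats \<and> invertible A \<and>
            g = Z_vec v ** P_vec b ** Z_mat B ** X_mat A)
    \<and> N \<lhd> (unitary_group\<lparr>carrier := G\<rparr>)
    \<and> subgroup X (unitary_group\<lparr>carrier := G\<rparr>)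
    \<and> N \<inter> X = {mat 1}
    \<and> N <#>\<^bsub>unitary_group\<^esub> X = G
    \<and> card G = 2 ^ (CARD('n) * (CARD('n) + 1)) * (\<Prod>i = 1..CARD('n). 2 ^ i - 1)"
proof (intro conjI)
  have GNX: "G = phase_linear_ops" "N = diag_op ` phase" "X = X_mat ` {A. invertible A}"
    unfolding G_def N_def X_def by (rule G_grp_eq N_grp_eq X_grp_eq)+
  have NG: "N \<subseteq> G" and XG: "X \<subseteq> G"
    unfolding G_def N_def X_def N_grp_def X_grp_def G_grp_def
    by (rule U.mono_generate, blast)+
  have subG: "subgroup G unitary_group"
    unfolding GNX by (rule subgroup_phase_linear_ops)
  interpret G: group "unitary_group\<lparr>carrier := G\<rparr>"
    using U.subgroup_imp_group[OF subG] .
  \<comment> \<open>A single bijection from the parameters onto \<open>G\<close> yields existence,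
    uniqueness and the order.\<close>
  let ?op = "\<lambda>(v, b, B, A). diag_op (normal_phase v b B) ** X_mat A"
  let ?T = "(UNIV :: (bit^'n) set) \<times> (UNIV :: (bit^'n) set) \<times> (Bmats :: (bit^'n^'n) set) \<times> {A :: bit^'n^'n. invertible A}"
  have inj: "inj_on ?op ?T"
    using diag_X_mat_inj normal_phase_in_phase normal_phase_inj
    by (intro inj_onI) (clarsimp, blast)
  have img: "?op ` ?T = G"
  proof
    show "?op ` ?T \<subseteq> G"
      unfolding GNX by (auto intro: phase_linear_opsI normal_phase_in_phase)
    show "G \<subseteq> ?op ` ?T"
    proof
      fix g assume "g \<in> G"
      then obtain f A where g: "g = diag_op f ** X_mat A" "f \<in> phase" "invertible A"
        unfolding GNX phase_linear_ops_def by auto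
      obtain v b B where "B \<in> Bmats" "f = normal_phase v b B"
        using phase_imp_normal[OF g(2)] by blast
      then have "(v, b, B, A) \<in> ?T" "g = ?op (v, b, B, A)" using g by auto
      then show "g \<in> ?op ` ?T" by (rule rev_image_eqI)
    qed
  qed
  show "\<forall>g \<in> G. \<exists>!(v, b, B, A). B \<in> Bmats \<and> invertible A \<and>
            g = Z_vec v ** P_vec b ** Z_mat B ** X_mat A"
  proof
    fix g assume "g \<in> G"
    then obtain t where t: "t \<in> ?T" "g = ?op t" using img by blast
    show "\<exists>!(v, b, B, A). B \<in> Bmats \<and> invertible A \<and>
            g = Z_vec v ** P_vec b ** Z_mat B ** X_mat A"
      unfolding normal_form_op
    proof (rule ex1I[of _ t])
      show "case t of (v, b, B, A) \<Rightarrow> B \<in> Bmats \<and> invertible A \<and>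
          g = diag_op (normal_phase v b B) ** X_mat A"
        using t by auto
      fix s :: "(bit^'n) \<times> (bit^'n) \<times> (bit^'n^'n) \<times> (bit^'n^'n)"
      assume "case s of (v, b, B, A) \<Rightarrow> B \<in> Bmats \<and> invertible A \<and>
          g = diag_op (normal_phase v b B) ** X_mat A"
      then have s: "s \<in> ?T" "g = ?op s" by auto
      have "?op s = ?op t" using s(2) t(2) by (rule trans[OF sym])
      then show "s = t" by (rule inj_onD[OF inj _ s(1) t(1)])
    qed
  qed
  show "subgroup X (unitary_group\<lparr>carrier := G\<rparr>)"
    using XG subG subgroup_X_mats unfolding GNX(3) by (intro U.subgroup_incl) auto
  show "N \<lhd> (unitary_group\<lparr>carrier := G\<rparr>)"
    unfolding G.normal_inv_iff
  proof (intro conjI ballI)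
    show "subgroup N (unitary_group\<lparr>carrier := G\<rparr>)"
      using NG subG subgroup_diag_phase unfolding GNX(2) by (intro U.subgroup_incl) auto
    fix g h assume g: "g \<in> carrier (unitary_group\<lparr>carrier := G\<rparr>)" and h: "h \<in> N"
    then have "g \<in> G" by simp
    moreover then have "g \<in> carrier unitary_group"
      using subG by (meson subgroup.mem_carrier)
    ultimately have "inv\<^bsub>unitary_group\<lparr>carrier := G\<rparr>\<^esub> g = adjoint g"
      using U.m_inv_consistent[OF subG] inv_unitary_group by simp
    then show "g \<otimes>\<^bsub>unitary_group\<lparr>carrier := G\<rparr>\<^esub> h \<otimes>\<^bsub>unitary_group\<lparr>carrier := G\<rparr>\<^esub>
        inv\<^bsub>unitary_group\<lparr>carrier := G\<rparr>\<^esub> g \<in> N"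
      using \<open>g \<in> G\<close> h phase_linear_ops_conj unfolding GNX by auto
  qed
  show "N \<inter> X = {mat 1}"
  proof
    show "N \<inter> X \<subseteq> {mat 1}"
    proof
      fix g assume "g \<in> N \<inter> X"
      then obtain f A where "g = diag_op f" "g = X_mat A" "f \<in> phase" "invertible A"
        unfolding GNX by blast
      \<comment> \<open>Padding both descriptions with a trivial factor gives two decompositions of
        the same operator, and uniqueness makes \<open>f\<close> constantly one.\<close>
      moreover then have "diag_op f ** X_mat (mat 1) = diag_op (\<lambda>_. 1) ** X_mat A"
        by (simp add: X_mat_one diag_op_one)
      ultimately show "g \<in> {mat 1}"
        using diag_X_mat_inj[OF _ _ invertible_mat_1] diag_op_one by blast
    qed
    show "{mat 1} \<subseteq> N \<inter> X"
      using subgroup.one_closed[OF subgroup_diag_phase] subgroup.one_closed[OF subgroup_X_mats]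
      unfolding GNX by simp
  qed
  show "N <#>\<^bsub>unitary_group\<^esub> X = G"
    unfolding GNX set_mult_def phase_linear_ops_def by auto
  have "card G = card ?T"
    using card_image[OF inj] img by simp
  also have "\<dots> = 2 ^ CARD('n) * (2 ^ CARD('n) * (2 ^ (CARD('n) choose 2) *
      (2 ^ (CARD('n) choose 2) * (\<Prod>i = 1..CARD('n). 2 ^ i - 1))))"
    unfolding card_cartesian_product card_Bmats card_invertible_bit prod_power_diff by simp
  also have "\<dots> = 2 ^ (2 * CARD('n) + 2 * (CARD('n) choose 2)) * (\<Prod>i = 1..CARD('n). 2 ^ i - 1)"
    by (simp add: power_add mult_2)
  \<comment> \<open>The parameters \<open>v\<close> and \<open>b\<close> contribute
    \<open>CARD('n)\<close> each; one binomial comes from \<open>B\<close>, the other from the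
    powers of two in the order of the general linear group.\<close>
  also have "2 * CARD('n) + 2 * (CARD('n) choose 2) = CARD('n) * (CARD('n) + 1)"
    by (cases "CARD('n)") (auto simp: choose_two)
  finally show "card G = 2 ^ (CARD('n) * (CARD('n) + 1)) * (\<Prod>i = 1..CARD('n). 2 ^ i - 1)" .
qed

end
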